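(* Let $s\geq5$ be an integer and $W$ a squarefree positive integer with $\gcd(24,W)=1$. Let $f:(\mathbb{Z}/24W)^{\times(2)}\to[0,1]$ be a function with $\mathbb{E}[f]>D_s$. Then for every $y\in\mathbb{Z}/24W$ with $y\equiv s\pmod{24}$ there exist $x_1,\dots,x_s\in(\mathbb{Z}/24W)^{\times(2)}$ with $y=x_1+\dots+x_s$ such that \[ \frac1s\big(f(x_1)+\dots+f(x_s)\big)>d_s\quad\text{and}\quad f(x_j)\neq0\text{ for all }1\leq j\leq s. \]
   Context: $(\mathbb{Z}/N)^{\times(2)}=\{x\in\mathbb{Z}/N: x=y^2 \text{ for some } y\in(\mathbb{Z}/N)^\times\}$; $\mathbb{E}[f]$ is the average of $f$ over its domain. For integers $s\geq5$: $D_s=59/60$ if $s=5$; $7/8$ if $s=6$; $3/4$ if $s=7$; $(s+13)/(4s)$ if $8\leq s\leq 12$; $1/2$ if $s\geq 13$. And $d_s=9/10$ if $s=5$; $5/6$ if $s=6$; $(s+13)/(4s)$ if $7\leq s\leq 12$; $1/2$ if $s\geq 13$. *)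

theory Defs
  imports Complex_Main "HOL-Number_Theory.Number_Theory"
    "HOL-Computational_Algebra.Squarefree"
begin

text \<open>
  The ring \<open>\<int>/N\<close> is the library's \<^term>\<open>residue_ring N\<close>, with carrier \<open>{0..N - 1}\<close>.
  It is only used with \<open>N > 1\<close>.
\<close>

definition unit_squares :: "int \<Rightarrow> int set" where
  "unit_squares N = {x \<in> carrier (residue_ring N).
     \<exists>y \<in> Units (residue_ring N). x = y [^]\<^bsub>residue_ring N\<^esub> (2::nat)}"

definition average_on :: "'a set \<Rightarrow> ('a \<Rightarrow> real) \<Rightarrow> real" where
  "average_on A f = (\<Sum>x\<in>A. f x) / real (card A)"

text \<open>Both thresholds are only meaningful for \<open>s \<ge> 5\<close>; below that the values are irrelevant.\<close>

definition D_threshold :: "nat \<Rightarrow> real" where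
  "D_threshold s =
     (if s = 5 then 59 / 60
      else if s = 6 then 7 / 8
      else if s = 7 then 3 / 4
      else if 8 \<le> s \<and> s \<le> 12 then (real s + 13) / (4 * real s)
      else 1 / 2)"

definition d_threshold :: "nat \<Rightarrow> real" where
  "d_threshold s =
     (if s = 5 then 9 / 10
      else if s = 6 then 5 / 6
      else if 7 \<le> s \<and> s \<le> 12 then (real s + 13) / (4 * real s)
      else 1 / 2)"

end

theory Submission
  imports Defs
begin

text \<open>
  Squares of units modulo 24 are \<open>1\<close>, so by the Chinese remainder theorem the problem lives on the
  product of the sets \<open>Q\<^sub>p\<close> of nonzero squares mod \<open>p\<close> for \<open>p dvd W\<close>. Fixing coordinates one
  prime at a time and replacing functions by their fibre averages, it is enough to choose, at each
  prime, residues with prescribed sum whose values add up to at least the sum of the averages.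

  At \<open>p\<close>, a set of top values of a decreasingly ordered function may be used, and
  Cauchy--Davenport makes the sums cover everything when the chosen ranks add up to \<open>p - 1\<close>. For
  \<open>p \<ge> 7\<close> three antithetic pairs of ranks \<open>t\<close>, \<open>n - 1 - t\<close> suffice, with \<open>n = (p - 1) / 2\<close>; for
  \<open>p \<ge> 11\<close> already a pair and a triple of nearly constant rank sum do, so five variables are
  enough.

  For \<open>s \<ge> 6\<close> only \<open>p = 5\<close>, where \<open>Q\<^sub>5 = {1, -1}\<close>, loses anything: the sum mod 5 can be
  realised with at most four variables at the worse residue, which accounts for the thresholds; the
  remaining fibre averages can be arranged in three pairs of sum greater than \<open>1\<close>, and
  this persists through all other primes and forces positivity. For \<open>s = 5\<close> the at most \<open>2 \<cdot> 3\<close>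
  unit squares modulo \<open>gcd 35 W\<close> all have fibre average above \<open>1 - 6 / 60 = 9 / 10\<close>, and five variables
  handle the primes from 11 on.
\<close>

section \<open>The Cauchy--Davenport theorem\<close>

definition sumset_mod :: "int \<Rightarrow> int set \<Rightarrow> int set \<Rightarrow> int set" where
  "sumset_mod p A B = (\<lambda>(a, b). (a + b) mod p) ` (A \<times> B)"

lemma sumset_modI: "a \<in> A \<Longrightarrow> b \<in> B \<Longrightarrow> (a + b) mod p \<in> sumset_mod p A B"
  unfolding sumset_mod_def by force

lemma sumset_mod_subset: "p > 0 \<Longrightarrow> sumset_mod p A B \<subseteq> {0..<p}"
  unfolding sumset_mod_def by auto

lemma inj_on_add_mod: "inj_on (\<lambda>a. (a + b) mod p) {0..<p}" for p :: int
proof (rule inj_onI)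
  fix x y assume xy: "x \<in> {0..<p}" "y \<in> {0..<p}" "(x + b) mod p = (y + b) mod p"
  then have "[x + b = y + b] (mod p)"
    by (simp add: cong_def)
  then have "[x = y] (mod p)"
    by (simp add: cong_add_rcancel)
  then show "x = y"
    using xy by (simp add: cong_def)
qed

lemma card_le_card_sumset_mod:
  assumes "p > 0" "A \<subseteq> {0..<p}" "b \<in> B"
  shows "card A \<le> card (sumset_mod p A B)"
proof (rule card_inj_on_le)
  show "inj_on (\<lambda>a. (a + b) mod p) A"
    using inj_on_add_mod assms(2) by (rule inj_on_subset)
  show "(\<lambda>a. (a + b) mod p) ` A \<subseteq> sumset_mod p A B"
    using assms(3) by (auto intro: sumset_modI)
  show "finite (sumset_mod p A B)"
    using sumset_mod_subset[OF assms(1)] finite_subset by blast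
qed

text \<open>As \<open>d\<close> is invertible modulo \<open>p\<close>, the points
  \<open>a + k * d\<close> run through all residues.\<close>

lemma translation_closed_mod_prime:
  assumes p: "prime p" and A: "A \<subseteq> {0..<p}" "A \<noteq> {}"
    and d: "\<not> p dvd d" and closed: "\<And>a. a \<in> A \<Longrightarrow> (a + d) mod p \<in> A"
  shows "A = {0..<p :: int}"
proof -
  obtain a where a: "a \<in> A"
    using A(2) by blast
  have p0: "p > 0"
    using p prime_gt_0_int by blast
  have iter: "(a + int k * d) mod p \<in> A" for k
  proof (induction k)
    case 0
    then show ?case
      using a A(1) by auto
  next
    case (Suc k)
    have "((a + int k * d) mod p + d) mod p = (a + int (Suc k) * d) mod p"
      by (simp add: mod_simps algebra_simps)
    then show ?case
      using closed[OF Suc] by simp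
  qed
  have "x \<in> A" if x: "x \<in> {0..<p}" for x
  proof -
    have "coprime d p"
      using p d by (metis coprime_commute prime_imp_coprime)
    then obtain t where t: "[d * t = x - a] (mod p)"
      using cong_solve_coprime_int[of d p] cong_scalar_right[of "d * _" 1 p "x - a"]
      by (metis mult.assoc mult_1)
    have "[a + int (nat (t mod p)) * d = a + t * d] (mod p)"
      using p0 by (intro cong_add cong_mult) (auto simp: cong_def)
    also have "[a + t * d = x] (mod p)"
      using cong_add[OF cong_refl[of a] t] by (simp add: mult.commute)
    finally have "(a + int (nat (t mod p)) * d) mod p = x"
      using x by (simp add: cong_def)
    then show ?thesis
      using iter[of "nat (t mod p)"] by simp
  qed
  then show ?thesis
    using A(1) by blast
qed

theorem Cauchy_Davenport:
  assumes p: "prime p"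
    and "A \<subseteq> {0..<p}" "A \<noteq> {}" "B \<subseteq> {0..<p}" "B \<noteq> {}"
  shows "min (nat p) (card A + card B - 1) \<le> card (sumset_mod p A B)"
  using assms(2-)
proof (induction "card B" arbitrary: A B rule: less_induct)
  case less
  note A = less.prems(1,2) and B = less.prems(3,4)
  have p0: "p > 0"
    using p prime_gt_0_int by blast
  have fin: "finite A" "finite B"
    using A B finite_subset by blast+
  show ?case
  proof (cases "\<forall>a\<in>A. \<forall>b\<in>B. \<forall>b'\<in>B. (a + (b' - b)) mod p \<in> A")
    case True
    show ?thesis
    proof (cases "card B = 1")
      case True
      then obtain b where "b \<in> B"
        using B by blast
      then show ?thesis
        using card_le_card_sumset_mod[OF p0 A(1)] True by fastforce
    next
      case False
      then obtain b b' where b: "b \<in> B" "b' \<in> B" "b \<noteq> b'"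
        using B(2) is_singletonI'[of B] by (auto simp: is_singleton_altdef)
      have "b mod p = b" "b' mod p = b'"
        using b(1,2) B(1) by auto
      then have "\<not> p dvd b' - b"
        using b(3) by (metis mod_eq_dvd_iff)
      then have "A = {0..<p}"
        using translation_closed_mod_prime[OF p A] True b by blast
      then have "card A = nat p"
        by simp
      then show ?thesis
        using card_le_card_sumset_mod[OF p0 A(1) b(1)] by linarith
    qed
  next
    case False
    then obtain a b b' where ab: "a \<in> A" "b \<in> B" "b' \<in> B" "(a + (b' - b)) mod p \<notin> A"
      by blast
    \<comment> \<open>Dyson's transform: move to \<open>A\<close> the part of \<open>B\<close> whose translate by \<open>a - b\<close> leaves \<open>A\<close>.\<close>
    define T where "T = (\<lambda>x. (x + (a - b)) mod p)"
    define B1 where "B1 = {x \<in> B. T x \<in> A}"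
    define B2 where "B2 = B - B1"
    \<comment> \<open>\<open>T b = a\<close> lies in \<open>A\<close> and \<open>T b'\<close> does
      not, so \<open>B1\<close> is nonempty and strictly smaller than \<open>B\<close>.\<close>
    have bB1: "b \<in> B1"
      using ab A(1) by (auto simp: B1_def T_def)
    have b'B1: "b' \<notin> B1"
      using ab by (simp add: B1_def T_def algebra_simps)
    have T: "inj_on T B"
      unfolding T_def using inj_on_add_mod B(1) by (rule inj_on_subset)
    have cB: "card B = card B1 + card B2"
      unfolding B2_def using fin(2)
      by (metis (no_types, lifting) B1_def card_Diff_subset card_mono finite_subset le_add_diff_inverse mem_Collect_eq subsetI)
    have cA: "card (A \<union> T ` B2) = card A + card B2"
      using fin T by (subst card_Un_disjoint)
        (auto simp: B2_def B1_def card_image inj_on_diff)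
    have "card B1 < card B"
      using ab(3) b'B1 fin(2) by (intro psubset_card_mono) (auto simp: B1_def)
    moreover have "A \<union> T ` B2 \<subseteq> {0..<p}" "A \<union> T ` B2 \<noteq> {}" "B1 \<subseteq> {0..<p}" "B1 \<noteq> {}"
      using A B(1) p0 bB1 by (auto simp: T_def B1_def)
    ultimately have "min (nat p) (card (A \<union> T ` B2) + card B1 - 1)
        \<le> card (sumset_mod p (A \<union> T ` B2) B1)"
      by (rule less.hyps)
    also have "sumset_mod p (A \<union> T ` B2) B1 \<subseteq> sumset_mod p A B"
    proof -
      have "(T x + z) mod p \<in> sumset_mod p A B" if "x \<in> B2" "z \<in> B1" for x z
      proof -
        \<comment> \<open>The shift moves from \<open>x\<close> to \<open>z\<close>: now
          \<open>T z\<close> lies in \<open>A\<close> and \<open>x\<close> in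
          \<open>B\<close>.\<close>
        have "(T x + z) mod p = (T z + x) mod p"
          by (simp add: T_def mod_simps algebra_simps)
        then show ?thesis
          using that by (auto simp: B1_def B2_def intro: sumset_modI)
      qed
      moreover have "(x + z) mod p \<in> sumset_mod p A B" if "x \<in> A" "z \<in> B1" for x z
        using that by (auto simp: B1_def intro: sumset_modI)
      ultimately show ?thesis
        by (auto simp: sumset_mod_def[of p "A \<union> T ` B2"])
    qed
    then have "card (sumset_mod p (A \<union> T ` B2) B1) \<le> card (sumset_mod p A B)"
      using sumset_mod_subset[OF p0] by (meson card_mono finite_atLeastLessThan_int finite_subset)
    finally show ?thesis
      using cA cB by simp
  qed
qed

text \<open>Iterated Cauchy-Davenport: starting from the empty sum, each set \<open>A i\<close> adds
  \<open>card (A i) - 1\<close> to the number of reachable residues until all \<open>p\<close> are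
  reached.\<close>

lemma sums_cover_mod_prime:
  fixes A :: "'i \<Rightarrow> int set"
  assumes p: "prime p" and "finite I"
    and A: "\<And>i. i \<in> I \<Longrightarrow> A i \<subseteq> {0..<p} \<and> A i \<noteq> {}"
    and card: "nat p \<le> 1 + (\<Sum>i\<in>I. card (A i) - 1)"
  shows "\<exists>x. (\<forall>i\<in>I. x i \<in> A i) \<and> [(\<Sum>i\<in>I. x i) = y] (mod p)"
proof -
  define R where "R = (\<lambda>J. {(\<Sum>i\<in>J. x i) mod p | x. \<forall>i\<in>J. x i \<in> A i})"
  have p0: "p > 0"
    using p prime_gt_0_int by blast
  have R: "R J \<subseteq> {0..<p}" for J
    using p0 by (auto simp: R_def)
  have "R J \<noteq> {} \<and> min (nat p) (1 + (\<Sum>i\<in>J. card (A i) - 1)) \<le> card (R J)" if "J \<subseteq> I" for J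
    using finite_subset[OF that assms(2)] that
  proof (induction J rule: finite_induct)
    case empty
    then show ?case
      by (simp add: R_def)
  next
    case (insert i J)
    have i: "A i \<subseteq> {0..<p}" "A i \<noteq> {}"
      using A insert.prems by auto
    have J: "R J \<noteq> {}" "min (nat p) (1 + (\<Sum>i\<in>J. card (A i) - 1)) \<le> card (R J)"
      using insert by auto
    have "sumset_mod p (R J) (A i) \<subseteq> R (insert i J)"
    proof
      fix z assume "z \<in> sumset_mod p (R J) (A i)"
      then obtain x a where x: "\<forall>i\<in>J. x i \<in> A i" "a \<in> A i" "z = ((\<Sum>i\<in>J. x i) mod p + a) mod p"
        by (auto simp: sumset_mod_def R_def)
      have "(\<Sum>j\<in>J. (x(i := a)) j) = (\<Sum>j\<in>J. x j)"
        using insert.hyps(2) by (intro sum.cong) auto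
      then have "z = (\<Sum>j\<in>insert i J. (x(i := a)) j) mod p"
        using x(3) insert.hyps by (simp add: mod_simps add.commute)
      moreover have "\<forall>j\<in>insert i J. (x(i := a)) j \<in> A j"
        using x by auto
      ultimately show "z \<in> R (insert i J)"
        unfolding R_def by blast
    qed
    then have "card (sumset_mod p (R J) (A i)) \<le> card (R (insert i J))"
      using R by (meson card_mono finite_atLeastLessThan_int finite_subset)
    moreover have "min (nat p) (card (R J) + card (A i) - 1) \<le> card (sumset_mod p (R J) (A i))"
      using Cauchy_Davenport[OF p R J(1) i] .
    moreover have "card (A i) > 0"
      using i finite_subset by (metis card_gt_0_iff finite_atLeastLessThan_int)
    moreover have "sumset_mod p (R J) (A i) \<noteq> {}"
      using J(1) i(2) by (simp add: sumset_mod_def)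
    ultimately show ?case
      using J \<open>sumset_mod p (R J) (A i) \<subseteq> R (insert i J)\<close> insert.hyps by auto
  qed
  then have "card {0..<p} \<le> card (R I)"
    using card by force
  then have "R I = {0..<p}"
    using R by (intro card_subset_eq card_seteq) auto
  then have "y mod p \<in> R I"
    using p0 by auto
  then show ?thesis
    by (auto simp: R_def cong_def)
qed

section \<open>Squares of units and the Chinese remainder theorem\<close>

text \<open>Congruence form of \<open>unit_squares\<close>. At modulus 1 it gives
  \<open>{0}\<close>, so trivial factors fit into the product decompositions.\<close>

definition usq :: "int \<Rightarrow> int set" where
  "usq N = {x \<in> {0..<N}. \<exists>y. coprime y N \<and> [x = y\<^sup>2] (mod N)}"

lemma unit_squares_eq_usq:
  assumes "N > 1"
  shows "unit_squares N = usq N"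
proof -
  interpret residues N "residue_ring N"
    by unfold_locales (use assms in auto)
  have pow: "y [^]\<^bsub>residue_ring N\<^esub> (2::nat) = y\<^sup>2 mod N" for y
    by (simp add: numeral_2_eq_2 nat_pow_Suc nat_pow_0 res_mult_eq res_one_eq mod_simps)
  show ?thesis
  proof (intro subset_antisym subsetI)
    fix x assume "x \<in> unit_squares N"
    then obtain y where "x \<in> {0..N-1}" "0 < y" "y < N" "coprime y N" "x = y\<^sup>2 mod N"
      by (auto simp: unit_squares_def res_carrier_eq res_units_eq pow)
    then show "x \<in> usq N"
      by (auto simp: usq_def cong_def)
  next
    fix x assume x: "x \<in> usq N"
    then obtain y where y: "coprime y N" "x \<in> {0..<N}" "[x = y\<^sup>2] (mod N)"
      by (auto simp: usq_def)
    then have "y mod N \<in> Units (residue_ring N)"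
      using assms mod_in_res_units by blast
    moreover have "x = (y mod N)\<^sup>2 mod N"
      using y by (simp add: cong_def power_mod)
    ultimately show "x \<in> unit_squares N"
      using y(2) by (auto simp: unit_squares_def res_carrier_eq pow)
  qed
qed

lemma usq_subset: "usq N \<subseteq> {0..<N}"
  by (auto simp: usq_def)

lemma finite_usq [simp]: "finite (usq N)"
  using usq_subset finite_subset by blast

lemma mod_usq_eq: "x \<in> usq N \<Longrightarrow> x mod N = x"
  by (auto simp: usq_def)

lemma one_in_usq: "N > 1 \<Longrightarrow> 1 \<in> usq N"
  by (auto simp: usq_def intro!: exI[of _ 1])

lemma usq_1: "usq 1 = {0}"
  by (auto simp: usq_def)

lemma usq_nonempty: "N > 0 \<Longrightarrow> usq N \<noteq> {}"
  using one_in_usq[of N] usq_1 by (cases "N = 1") auto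

text \<open>Square roots modulo the factors glue to a root modulo the product, again coprime to
  it.\<close>

lemma usq_mult_iff:
  assumes "M > 0" "N > 0" "coprime M N"
  shows "x \<in> usq (M * N) \<longleftrightarrow> x \<in> {0..<M * N} \<and> x mod M \<in> usq M \<and> x mod N \<in> usq N"
proof
  assume "x \<in> usq (M * N)"
  then obtain y where y: "x \<in> {0..<M * N}" "coprime y (M * N)" "[x = y\<^sup>2] (mod M * N)"
    by (auto simp: usq_def)
  have "[x = y\<^sup>2] (mod M)" "[x = y\<^sup>2] (mod N)"
    using y(3) by (auto elim: cong_dvd_modulus)
  then show "x \<in> {0..<M * N} \<and> x mod M \<in> usq M \<and> x mod N \<in> usq N"
    using y(1,2) assms by (auto simp: usq_def)
next
  assume x: "x \<in> {0..<M * N} \<and> x mod M \<in> usq M \<and> x mod N \<in> usq N"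
  then obtain y z where y: "coprime y M" "[x = y\<^sup>2] (mod M)" and z: "coprime z N" "[x = z\<^sup>2] (mod N)"
    by (auto simp: usq_def)
  obtain w where w: "[w = y] (mod M)" "[w = z] (mod N)"
    using binary_chinese_remainder_int[OF assms(3)] by blast
  have "coprime w M" "coprime w N"
    using w y(1) z(1) by (metis cong_imp_coprime cong_sym)+
  moreover have "[x = w\<^sup>2] (mod M)" "[x = w\<^sup>2] (mod N)"
    using w y(2) z(2) by (meson cong_pow cong_sym cong_trans)+
  ultimately show "x \<in> usq (M * N)"
    using x assms(3) by (auto simp: usq_def intro!: exI[of _ w] coprime_cong_mult)
qed

text \<open>For positive coprime moduli the range makes the solution unique, so \<open>SOME\<close>
  involves no real choice.\<close>

definition crt :: "int \<Rightarrow> int \<Rightarrow> int \<Rightarrow> int \<Rightarrow> int" where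
  "crt M N u v = (SOME x. x \<in> {0..<M * N} \<and> [x = u] (mod M) \<and> [x = v] (mod N))"

context
  fixes M N :: int
  assumes MN: "M > 0" "N > 0" "coprime M N"
begin

lemma crt_in_range: "crt M N u v \<in> {0..<M * N}"
  and crt_cong1: "[crt M N u v = u] (mod M)"
  and crt_cong2: "[crt M N u v = v] (mod N)"
proof -
  obtain x where x: "[x = u] (mod M)" "[x = v] (mod N)"
    using binary_chinese_remainder_int[OF MN(3)] by blast
  have "[x mod (M * N) = u] (mod M)" "[x mod (M * N) = v] (mod N)"
    using x by (auto simp: cong_def mod_mod_cancel)
  moreover have "x mod (M * N) \<in> {0..<M * N}"
    using MN by simp
  ultimately have "\<exists>x. x \<in> {0..<M * N} \<and> [x = u] (mod M) \<and> [x = v] (mod N)"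
    by blast
  from someI_ex[OF this] show "crt M N u v \<in> {0..<M * N}"
    "[crt M N u v = u] (mod M)" "[crt M N u v = v] (mod N)"
    by (auto simp: crt_def)
qed

lemma crt_in_usq: "u \<in> usq M \<Longrightarrow> v \<in> usq N \<Longrightarrow> crt M N u v \<in> usq (M * N)"
  using crt_in_range crt_cong1[of u v] crt_cong2[of u v]
  by (auto simp: usq_mult_iff[OF MN] cong_def mod_usq_eq)

lemma sum_crt_cong:
  assumes "[(\<Sum>i\<in>I. u i) = y] (mod M)" "[(\<Sum>i\<in>I. v i) = y] (mod N)"
  shows "[(\<Sum>i\<in>I. crt M N (u i) (v i)) = y] (mod M * N)"
proof (rule coprime_cong_mult)
  show "[(\<Sum>i\<in>I. crt M N (u i) (v i)) = y] (mod M)"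
    by (rule cong_trans[OF cong_sum assms(1)]) (rule crt_cong1)
  show "[(\<Sum>i\<in>I. crt M N (u i) (v i)) = y] (mod N)"
    by (rule cong_trans[OF cong_sum assms(2)]) (rule crt_cong2)
qed (rule MN(3))

lemma bij_betw_crt: "bij_betw (\<lambda>(u, v). crt M N u v) (usq M \<times> usq N) (usq (M * N))"
proof (rule bij_betw_byWitness[where f' = "\<lambda>x. (x mod M, x mod N)"])
  show "\<forall>a\<in>usq M \<times> usq N.
       (\<lambda>x. (x mod M, x mod N)) (case a of (u, v) \<Rightarrow> crt M N u v) = a"
    using crt_cong1 crt_cong2 by (auto simp: cong_def mod_usq_eq)
  show "\<forall>x\<in>usq (M * N).
       (case (x mod M, x mod N) of (u, v) \<Rightarrow> crt M N u v) = x"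
  proof
    fix x assume x: "x \<in> usq (M * N)"
    define z where "z = crt M N (x mod M) (x mod N)"
    have "[z = x] (mod M)" "[z = x] (mod N)"
      unfolding z_def using crt_cong1[of "x mod M" "x mod N"] crt_cong2[of "x mod M" "x mod N"]
      by (auto simp: cong_def)
    then have "[z = x] (mod M * N)"
      using MN(3) by (rule coprime_cong_mult)
    moreover have "z \<in> {0..<M * N}"
      unfolding z_def by (rule crt_in_range)
    ultimately show "(case (x mod M, x mod N) of (u, v) \<Rightarrow> crt M N u v) = x"
      using x usq_subset[of "M * N"] by (auto simp: z_def cong_def)
  qed
  show "(\<lambda>(u, v). crt M N u v) ` (usq M \<times> usq N) \<subseteq> usq (M * N)"
    using crt_in_usq by auto
  show "(\<lambda>x. (x mod M, x mod N)) ` usq (M * N) \<subseteq> usq M \<times> usq N"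
    by (auto simp: usq_mult_iff[OF MN])
qed

text \<open>Fubini along the bijection \<open>crt\<close>; the inner averages are the fibre averages
  that act as functions at the outer modulus.\<close>

lemma average_on_usq_mult:
  "average_on (usq (M * N)) h =
    average_on (usq M) (\<lambda>u. average_on (usq N) (\<lambda>v. h (crt M N u v)))"
proof -
  have "(\<Sum>x\<in>usq (M * N). h x) = (\<Sum>(u, v)\<in>usq M \<times> usq N. h (crt M N u v))"
    using sum.reindex_bij_betw[OF bij_betw_crt, of h] by (simp add: case_prod_unfold)
  also have "\<dots> = (\<Sum>u\<in>usq M. \<Sum>v\<in>usq N. h (crt M N u v))"
    by (simp add: sum.cartesian_product)
  finally have "(\<Sum>x\<in>usq (M * N). h x) = (\<Sum>u\<in>usq M. \<Sum>v\<in>usq N. h (crt M N u v))" .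
  moreover have "card (usq (M * N)) = card (usq M) * card (usq N)"
    using bij_betw_same_card[OF bij_betw_crt] by (simp add: card_cartesian_product)
  ultimately show ?thesis
    by (simp add: average_on_def sum_divide_distrib[symmetric])
qed

end

lemma card_usq_mult:
  "M > 0 \<Longrightarrow> N > 0 \<Longrightarrow> coprime M N \<Longrightarrow> card (usq (M * N)) = card (usq M) * card (usq N)"
  using bij_betw_same_card[OF bij_betw_crt] by (simp add: card_cartesian_product)

section \<open>Block solvability and its multiplicativity\<close>

text \<open>
  The functions \<open>g i\<close> are allowed to differ, since fixing different residues modulo one factor
  turns a single function into different ones; this is what makes the notion multiplicative.
\<close>

definition block_solvable :: "'i set \<Rightarrow> 'i set set \<Rightarrow> int \<Rightarrow> bool" where
  "block_solvable I P N \<longleftrightarrow> (\<forall>(g :: 'i \<Rightarrow> int \<Rightarrow> real) y. \<exists>x. (\<forall>i\<in>I. x i \<in> usq N) \<and>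
     [(\<Sum>i\<in>I. x i) = y] (mod N) \<and>
     (\<forall>B\<in>P. (\<Sum>i\<in>B. average_on (usq N) (g i)) \<le> (\<Sum>i\<in>B. g i (x i))))"

lemma block_solvable_1: "block_solvable I P 1"
  by (auto simp: block_solvable_def usq_1 average_on_def intro!: exI[of _ "\<lambda>_. 0"])

text \<open>First solve modulo \<open>M\<close> for the fibre averages, then modulo \<open>N\<close>
  for the functions on the chosen fibres. The two block inequalities chain.\<close>

lemma block_solvable_mult:
  assumes MN: "M > 0" "N > 0" "coprime M N"
    and "block_solvable I P M" "block_solvable I P N"
  shows "block_solvable I P (M * N)"
  unfolding block_solvable_def
proof (intro allI)
  fix g :: "'a \<Rightarrow> int \<Rightarrow> real" and y
  obtain u where u: "\<forall>i\<in>I. u i \<in> usq M" "[(\<Sum>i\<in>I. u i) = y] (mod M)"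
    "\<forall>B\<in>P. (\<Sum>i\<in>B. average_on (usq M) (\<lambda>u. average_on (usq N) (\<lambda>v. g i (crt M N u v))))
        \<le> (\<Sum>i\<in>B. average_on (usq N) (\<lambda>v. g i (crt M N (u i) v)))"
    using assms(4)[unfolded block_solvable_def, rule_format,
        of y "\<lambda>i u. average_on (usq N) (\<lambda>v. g i (crt M N u v))"] by blast
  obtain v where v: "\<forall>i\<in>I. v i \<in> usq N" "[(\<Sum>i\<in>I. v i) = y] (mod N)"
    "\<forall>B\<in>P. (\<Sum>i\<in>B. average_on (usq N) (\<lambda>v. g i (crt M N (u i) v)))
        \<le> (\<Sum>i\<in>B. g i (crt M N (u i) (v i)))"
    using assms(5)[unfolded block_solvable_def, rule_format,
        of y "\<lambda>i v. g i (crt M N (u i) v)"] by blast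
  show "\<exists>x. (\<forall>i\<in>I. x i \<in> usq (M * N)) \<and> [(\<Sum>i\<in>I. x i) = y] (mod M * N) \<and>
     (\<forall>B\<in>P. (\<Sum>i\<in>B. average_on (usq (M * N)) (g i)) \<le> (\<Sum>i\<in>B. g i (x i)))"
  proof (intro exI conjI)
    show "\<forall>i\<in>I. crt M N (u i) (v i) \<in> usq (M * N)"
      using u(1) v(1) crt_in_usq[OF MN] by blast
    show "[(\<Sum>i\<in>I. crt M N (u i) (v i)) = y] (mod M * N)"
      using sum_crt_cong[OF MN u(2) v(2)] .
    show "\<forall>B\<in>P. (\<Sum>i\<in>B. average_on (usq (M * N)) (g i)) \<le> (\<Sum>i\<in>B. g i (crt M N (u i) (v i)))"
      using u(3) v(3) order_trans by (simp add: average_on_usq_mult[OF MN]) blast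
  qed
qed

lemma squarefree_mult_imp_coprime:
  fixes a b :: int
  assumes "squarefree (a * b)"
  shows "coprime a b"
proof (rule coprimeI)
  fix c assume "c dvd a" "c dvd b"
  then have "c\<^sup>2 dvd a * b"
    by (simp add: power2_eq_square mult_dvd_mono)
  then show "is_unit c"
    using assms squarefreeD by blast
qed

lemma block_solvable_squarefree:
  assumes "N > 0" "squarefree N"
    and "\<And>p. prime p \<Longrightarrow> p dvd N \<Longrightarrow> block_solvable I P p"
  shows "block_solvable I P N"
  using assms
proof (induction "nat N" arbitrary: N rule: less_induct)
  case less
  show ?case
  proof (cases "N = 1")
    case True
    then show ?thesis
      by (simp add: block_solvable_1)
  next
    case False
    then obtain p where p: "prime p" "p dvd N"
      using less.prems(1) prime_divisor_exists[of N] by auto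
    then obtain K where K: "N = p * K"
      by blast
    have "p > 1"
      using p(1) prime_gt_1_int by blast
    then have K0: "K > 0" "nat K < nat N"
      using less.prems(1) K by (auto simp: zero_less_mult_iff)
    have "coprime p K"
      using less.prems(2) K squarefree_mult_imp_coprime by blast
    moreover have "block_solvable I P K"
      using less.hyps[OF K0(2,1)] less.prems(2,3) K squarefree_multD(2) by fastforce
    ultimately show ?thesis
      using block_solvable_mult[of p K] less.prems(3)[OF p] \<open>p > 1\<close> K0(1) K by simp
  qed
qed

section \<open>Prime moduli\<close>

lemma exists_ge_average_on:
  assumes "finite A" "A \<noteq> {}"
  shows "\<exists>x\<in>A. average_on A f \<le> f x"
proof (rule ccontr)
  assume "\<not> ?thesis"
  then have "(\<Sum>x\<in>A. f x) < (\<Sum>x\<in>A. average_on A f)"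
    using assms by (intro sum_strict_mono) auto
  also have "\<dots> = (\<Sum>x\<in>A. f x)"
    using assms by (simp add: average_on_def)
  finally show False
    by simp
qed

lemma average_on_add: "average_on A (\<lambda>x. f x + g x) = average_on A f + average_on A g"
  by (simp add: average_on_def sum.distrib add_divide_distrib)

lemma average_on_reindex:
  assumes "bij_betw e A B"
  shows "average_on A (\<lambda>x. f (e x)) = average_on B f"
  using sum.reindex_bij_betw[OF assms, of f] bij_betw_same_card[OF assms]
  by (simp add: average_on_def)

lemma decreasing_enumeration:
  fixes g :: "'a \<Rightarrow> real"
  assumes "finite S"
  obtains e where "bij_betw e {..<card S} S"
    and "\<And>i j. i \<le> j \<Longrightarrow> j < card S \<Longrightarrow> g (e j) \<le> g (e i)"
proof -
  obtain ys where ys: "set ys = S" "distinct ys"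
    using finite_distinct_list[OF assms] by blast
  define xs where "xs = sort_key (\<lambda>x. - g x) ys"
  have xs: "set xs = S" "distinct xs"
    using ys by (auto simp: xs_def)
  then have len: "length xs = card S"
    using distinct_card by fastforce
  show ?thesis
  proof (rule that)
    show "bij_betw (\<lambda>i. xs ! i) {..<card S} S"
      using bij_betw_nth[OF xs(2)] xs(1) len by simp
    show "g (xs ! j) \<le> g (xs ! i)" if "i \<le> j" "j < card S" for i j
    proof -
      have "sorted (map (\<lambda>x. - g x) xs)"
        by (simp add: xs_def)
      then show ?thesis
        using sorted_nth_mono[of "map (\<lambda>x. - g x) xs" i j] that len by simp
    qed
  qed
qed

section \<open>Choosing ranks by averaging over permutations\<close>

text \<open>Reversal permutes \<open>{..<n}\<close>, so some \<open>t\<close> does at least as well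
  as the average, and the rank sum is \<open>n - 1\<close> whichever \<open>t\<close> it is.\<close>

lemma antithetic_pair:
  fixes a b :: "nat \<Rightarrow> real"
  assumes "n > 0"
  shows "\<exists>t<n. average_on {..<n} a + average_on {..<n} b \<le> a t + b (n - 1 - t)"
proof -
  have "bij_betw (\<lambda>t. n - 1 - t) {..<n} {..<n}"
    by (rule bij_betw_byWitness[where f' = "\<lambda>t. n - 1 - t"]) (use assms in auto)
  from average_on_reindex[OF this, of b]
  have "average_on {..<n} a + average_on {..<n} b = average_on {..<n} (\<lambda>t. a t + b (n - 1 - t))"
    by (simp add: average_on_add)
  then show ?thesis
    using exists_ge_average_on[of "{..<n}" "\<lambda>t. a t + b (n - 1 - t)"] assms by auto
qed

text \<open>
  Three rearrangements \<open>t\<close>, \<open>\<sigma> t\<close>, \<open>\<tau> t\<close> of \<open>{..<n}\<close> whose sum is nearly constant: \<open>\<sigma>\<close> is the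
  rotation by half the range and \<open>\<tau>\<close> undoes the variation of \<open>t + \<sigma> t\<close>.
\<close>

lemma balanced_triple:
  fixes a b c :: "nat \<Rightarrow> real"
  assumes "n > 0"
  shows "\<exists>i<n. \<exists>j<n. \<exists>k<n. 3 * n \<le> 2 * (i + j + k) + 4 \<and>
    average_on {..<n} a + average_on {..<n} b + average_on {..<n} c \<le> a i + b j + c k"
proof -
  define m where "m = n div 2"
  define \<sigma> where "\<sigma> = (\<lambda>t. if t + m < n then t + m else t + m - n)"
  define \<tau> where "\<tau> = (\<lambda>t. if even n then (if t < m then n - 1 - 2 * t else 2 * n - 2 - 2 * t)
    else (if t \<le> m then n - 1 - 2 * t else 2 * n - 1 - 2 * t))"
  have \<sigma>: "bij_betw \<sigma> {..<n} {..<n}"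
  proof -
    have "inj_on \<sigma> {..<n}" "\<sigma> ` {..<n} \<subseteq> {..<n}"
      using assms by (auto simp: inj_on_def \<sigma>_def m_def split: if_splits)
    then show ?thesis
      by (simp add: bij_betw_def endo_inj_surj)
  qed
  have n: "n = (if even n then 2 * m else 2 * m + 1)"
    by (simp add: m_def)
  have \<tau>_lt: "\<tau> x < n" if "x < n" for x
    using that n unfolding \<tau>_def by (cases "even n") auto
  \<comment> \<open>The two branches of \<open>\<tau>\<close> take values of opposite parity, so
    they cannot collide.\<close>
  have "inj_on \<tau> {..<n}"
  proof (cases "even n")
    case True
    then have "\<tau> x = (if x < m then 2 * m - 1 - 2 * x else 4 * m - 2 - 2 * x)" for x
      using n by (simp add: \<tau>_def)
    then show ?thesis
      using True n by (intro inj_onI) (auto split: if_splits; presburger)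
  next
    case False
    then have "\<tau> x = (if x \<le> m then 2 * m - 2 * x else 4 * m + 1 - 2 * x)" for x
      using n by (simp add: \<tau>_def)
    then show ?thesis
      using False n by (intro inj_onI) (auto split: if_splits; presburger)
  qed
  then have \<tau>: "bij_betw \<tau> {..<n} {..<n}"
    using \<tau>_lt by (auto simp: bij_betw_def endo_inj_surj image_subset_iff)
  have "average_on {..<n} a + average_on {..<n} b + average_on {..<n} c =
      average_on {..<n} (\<lambda>t. a t + b (\<sigma> t) + c (\<tau> t))"
    by (simp add: average_on_add average_on_reindex[OF \<sigma>] average_on_reindex[OF \<tau>])
  then obtain t where t: "t < n" "average_on {..<n} a + average_on {..<n} b + average_on {..<n} c
      \<le> a t + b (\<sigma> t) + c (\<tau> t)"
    using exists_ge_average_on[of "{..<n}" "\<lambda>t. a t + b (\<sigma> t) + c (\<tau> t)"] assms by auto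
  \<comment> \<open>The rank sum is \<open>3 * m\<close> for odd \<open>n\<close>, and
    \<open>3 * m - 1\<close> or \<open>3 * m - 2\<close> for even \<open>n\<close>. The last value
    makes the constant 4 sharp.\<close>
  have "3 * n \<le> 2 * (t + \<sigma> t + \<tau> t) + 4"
    using t(1) n unfolding \<sigma>_def \<tau>_def by (cases "even n") auto
  moreover have "\<sigma> t < n" "\<tau> t < n"
    using \<sigma> \<tau> t(1) by (auto simp: bij_betw_def)
  ultimately show ?thesis
    using t by blast
qed

text \<open>
  Order each \<open>g i\<close> decreasingly. Taking \<open>x i\<close> among the \<open>j i + 1\<close> best points costs nothing below
  the value at index \<open>j i\<close>, and by Cauchy--Davenport the sums cover everything once
  \<open>\<Sum>i. j i \<ge> p - 1\<close>.
\<close>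

definition index_choice :: "nat \<Rightarrow> nat \<Rightarrow> 'i set \<Rightarrow> 'i set set \<Rightarrow> bool" where
  "index_choice n k I P \<longleftrightarrow> (\<forall>a :: 'i \<Rightarrow> nat \<Rightarrow> real. \<exists>j. (\<forall>i\<in>I. j i < n) \<and> k \<le> (\<Sum>i\<in>I. j i) \<and>
     (\<forall>B\<in>P. (\<Sum>i\<in>B. average_on {..<n} (a i)) \<le> (\<Sum>i\<in>B. a i (j i))))"

lemma block_solvable_prime:
  assumes p: "prime p" and I: "finite I" "\<Union>P \<subseteq> I"
    and choice: "index_choice (card (usq p)) (nat p - 1) I P"
  shows "block_solvable I P p"
  unfolding block_solvable_def
proof (intro allI)
  fix g :: "'a \<Rightarrow> int \<Rightarrow> real" and y
  define n where "n = card (usq p)"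
  have "\<exists>e. bij_betw e {..<n} (usq p) \<and> (\<forall>s t. s \<le> t \<longrightarrow> t < n \<longrightarrow> g i (e t) \<le> g i (e s))" for i
    using decreasing_enumeration[of "usq p" "g i"] unfolding n_def by (metis finite_usq)
  then obtain e where e: "\<And>i. bij_betw (e i) {..<n} (usq p)"
    "\<And>i s t. s \<le> t \<Longrightarrow> t < n \<Longrightarrow> g i (e i t) \<le> g i (e i s)"
    by metis
  obtain j where j: "\<forall>i\<in>I. j i < n" "nat p - 1 \<le> (\<Sum>i\<in>I. j i)"
    "\<forall>B\<in>P. (\<Sum>i\<in>B. average_on {..<n} (\<lambda>t. g i (e i t))) \<le> (\<Sum>i\<in>B. g i (e i (j i)))"
    using choice[unfolded index_choice_def, rule_format, of "\<lambda>i t. g i (e i t)"]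
    unfolding n_def by blast
  have sub: "{..j i} \<subseteq> {..<n}" if "i \<in> I" for i
    using j(1) that by auto
  have "\<exists>x. (\<forall>i\<in>I. x i \<in> e i ` {..j i}) \<and> [(\<Sum>i\<in>I. x i) = y] (mod p)"
  proof (rule sums_cover_mod_prime[OF p I(1)])
    fix i assume i: "i \<in> I"
    have "e i ` {..j i} \<subseteq> usq p"
      using e(1)[of i] sub[OF i] by (auto simp: bij_betw_def)
    then show "e i ` {..j i} \<subseteq> {0..<p} \<and> e i ` {..j i} \<noteq> {}"
      using usq_subset by auto
  next
    \<comment> \<open>Including rank \<open>j i\<close> itself gives \<open>j i + 1\<close>
      candidates, so each variable contributes exactly \<open>j i\<close> to the covering
      count.\<close>
    have "card (e i ` {..j i}) = Suc (j i)" if "i \<in> I" for i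
      using card_image[OF inj_on_subset[OF bij_betw_imp_inj_on[OF e(1)] sub[OF that]]] by simp
    then show "nat p \<le> 1 + (\<Sum>i\<in>I. card (e i ` {..j i}) - 1)"
      using j(2) by simp
  qed
  then obtain x where x: "\<forall>i\<in>I. x i \<in> e i ` {..j i}" "[(\<Sum>i\<in>I. x i) = y] (mod p)"
    by blast
  have "x i \<in> usq p" "g i (e i (j i)) \<le> g i (x i)" if i: "i \<in> I" for i
  proof -
    obtain t where t: "t \<le> j i" "x i = e i t"
      using x(1) i by blast
    then show "g i (e i (j i)) \<le> g i (x i)"
      using e(2) j(1) i by auto
    show "x i \<in> usq p"
      using bij_betwE[OF e(1)] sub[OF i] t by auto
  qed
  moreover from this have "(\<Sum>i\<in>B. average_on (usq p) (g i)) \<le> (\<Sum>i\<in>B. g i (x i))" if "B \<in> P" for B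
  proof -
    have "(\<Sum>i\<in>B. g i (e i (j i))) \<le> (\<Sum>i\<in>B. g i (x i))"
      using I(2) that \<open>\<And>i. i \<in> I \<Longrightarrow> g i (e i (j i)) \<le> g i (x i)\<close> by (intro sum_mono) auto
    then show ?thesis
      using j(3) that by (simp add: average_on_reindex[OF e(1)]) force
  qed
  ultimately show "\<exists>x. (\<forall>i\<in>I. x i \<in> usq p) \<and> [(\<Sum>i\<in>I. x i) = y] (mod p) \<and>
     (\<forall>B\<in>P. (\<Sum>i\<in>B. average_on (usq p) (g i)) \<le> (\<Sum>i\<in>B. g i (x i)))"
    using x(2) by blast
qed

lemma index_choice_no_blocks:
  assumes "n > 0" "k \<le> card I * (n - 1)"
  shows "index_choice n k I {}"
  unfolding index_choice_def by (rule allI, rule exI[of _ "\<lambda>_. n - 1"]) (use assms in auto)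

text \<open>The pair has rank sum \<open>n - 1\<close>; the triple has at least half of
  \<open>3 * n - 4\<close> rounded up, which is \<open>(3 * n - 3) div 2\<close>.\<close>

lemma index_choice_5:
  assumes "n > 0" "k \<le> n - 1 + (3 * n - 3) div 2"
  shows "index_choice n k {1..5::nat} {{1, 2}, {3, 4, 5}}"
  unfolding index_choice_def
proof
  fix a :: "nat \<Rightarrow> nat \<Rightarrow> real"
  obtain t where t: "t < n"
    "average_on {..<n} (a 1) + average_on {..<n} (a 2) \<le> a 1 t + a 2 (n - 1 - t)"
    using antithetic_pair[OF assms(1)] by blast
  obtain u v w where u: "u < n" "v < n" "w < n" "3 * n \<le> 2 * (u + v + w) + 4"
    "average_on {..<n} (a 3) + average_on {..<n} (a 4) + average_on {..<n} (a 5) \<le> a 3 u + a 4 v + a 5 w"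
    using balanced_triple[OF assms(1)] by blast
  define j where "j = (\<lambda>i::nat. if i = 1 then t else if i = 2 then n - 1 - t
    else if i = 3 then u else if i = 4 then v else w)"
  have I: "{1..5::nat} = {1, 2, 3, 4, 5}"
    by auto
  have "\<forall>i\<in>{1..5}. j i < n"
    using t(1) u assms(1) by (simp add: j_def)
  moreover
  have sum: "(\<Sum>i\<in>{1..5}. j i) = t + (n - 1 - t) + (u + v + w)"
    unfolding I by (simp add: j_def)
  have "k \<le> (\<Sum>i\<in>{1..5}. j i)"
  proof -
    have "(3 * n - 3) div 2 \<le> u + v + w"
      using u(4) by presburger
    then show ?thesis
      using t(1) assms sum by linarith
  qed
  moreover have "\<forall>B\<in>{{1, 2}, {3, 4, 5}}. (\<Sum>i\<in>B. average_on {..<n} (a i)) \<le> (\<Sum>i\<in>B. a i (j i))"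
    using t(2) u(5) by (simp add: j_def add.assoc)
  ultimately show "\<exists>j. (\<forall>i\<in>{1..5}. j i < n) \<and> k \<le> (\<Sum>i\<in>{1..5}. j i) \<and>
     (\<forall>B\<in>{{1, 2}, {3, 4, 5}}. (\<Sum>i\<in>B. average_on {..<n} (a i)) \<le> (\<Sum>i\<in>B. a i (j i)))"
    by blast
qed

text \<open>Three antithetic pairs, each of rank sum \<open>n - 1\<close>. Pairing \<open>i\<close>
  with \<open>i + 3\<close> puts one of the first three variables into every pair; this pays off
  when variables at the worse residue modulo 5 are listed last.\<close>

lemma index_choice_6:
  assumes "n > 0" "k \<le> 3 * (n - 1)"
  shows "index_choice n k {1..6::nat} {{1, 4}, {2, 5}, {3, 6}}"
  unfolding index_choice_def
proof
  fix a :: "nat \<Rightarrow> nat \<Rightarrow> real"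
  have "\<forall>i. \<exists>t. t < n \<and> average_on {..<n} (a i) + average_on {..<n} (a (i + 3)) \<le> a i t + a (i + 3) (n - 1 - t)"
    using antithetic_pair[OF assms(1)] by blast
  then obtain t where t: "\<And>i. t i < n"
    "\<And>i. average_on {..<n} (a i) + average_on {..<n} (a (i + 3)) \<le> a i (t i) + a (i + 3) (n - 1 - t i)"
    by (auto dest!: choice)
  define j where "j = (\<lambda>i. if i \<le> 3 then t i else n - 1 - t (i - 3))"
  have I: "{1..6::nat} = {1, 2, 3, 4, 5, 6}"
    by auto
  have "\<forall>i\<in>{1..6}. j i < n"
    using t(1) assms(1) by (simp add: j_def)
  moreover have "(\<Sum>i\<in>{1..6}. j i) = (t 1 + (n - 1 - t 1)) + (t 2 + (n - 1 - t 2)) + (t 3 + (n - 1 - t 3))"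
    unfolding I by (simp add: j_def)
  then have "k \<le> (\<Sum>i\<in>{1..6}. j i)"
    using t(1)[of 1] t(1)[of 2] t(1)[of 3] assms by linarith
  moreover have "\<forall>B\<in>{{1, 4}, {2, 5}, {3, 6}}. (\<Sum>i\<in>B. average_on {..<n} (a i)) \<le> (\<Sum>i\<in>B. a i (j i))"
    using t(2)[of 1] t(2)[of 2] t(2)[of 3] by (simp add: j_def)
  ultimately show "\<exists>j. (\<forall>i\<in>{1..6}. j i < n) \<and> k \<le> (\<Sum>i\<in>{1..6}. j i) \<and>
     (\<forall>B\<in>{{1, 4}, {2, 5}, {3, 6}}. (\<Sum>i\<in>B. average_on {..<n} (a i)) \<le> (\<Sum>i\<in>B. a i (j i)))"
    by blast
qed

section \<open>Counting squares and the resulting bounds on primes\<close>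

text \<open>The squares of \<open>1\<close> up to \<open>(p - 1) div 2\<close> are distinct:
  \<open>p\<close> would divide \<open>(x - y) * (x + y)\<close>, while \<open>x + y\<close> lies
  strictly between \<open>0\<close> and \<open>p\<close>.\<close>

lemma card_usq_prime_ge:
  assumes p: "prime p" "p > 2"
  shows "nat p \<le> 2 * card (usq p) + 1"
proof -
  have "card ((\<lambda>y. y\<^sup>2 mod p) ` {1..(p - 1) div 2}) \<le> card (usq p)"
  proof (rule card_mono)
    show "(\<lambda>y. y\<^sup>2 mod p) ` {1..(p - 1) div 2} \<subseteq> usq p"
    proof (rule image_subsetI)
      fix y assume "y \<in> {1..(p - 1) div 2}"
      then have "0 < y" "y < p"
        by auto
      then have "\<not> p dvd y"
        using zdvd_not_zless by blast
      then have "coprime y p"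
        using p(1) by (metis coprime_commute prime_imp_coprime)
      then show "y\<^sup>2 mod p \<in> usq p"
        using p(2) by (auto simp: usq_def cong_def)
    qed
  qed simp
  moreover have "inj_on (\<lambda>y. y\<^sup>2 mod p) {1..(p - 1) div 2}"
  proof (rule inj_onI)
    fix x y assume xy: "x \<in> {1..(p - 1) div 2}" "y \<in> {1..(p - 1) div 2}" "x\<^sup>2 mod p = y\<^sup>2 mod p"
    then have "p dvd (x - y) * (x + y)"
      by (simp add: mod_eq_dvd_iff power2_eq_square algebra_simps)
    then have "p dvd x - y \<or> p dvd x + y"
      using p(1) by (simp add: prime_dvd_mult_iff)
    moreover have "\<not> p dvd x + y"
      using xy(1,2) by (intro zdvd_not_zless) auto
    ultimately have "p dvd x - y"
      by blast
    moreover have "\<bar>x - y\<bar> < \<bar>p\<bar>"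
      using xy(1,2) p(2) by auto
    ultimately show "x = y"
      using dvd_imp_le_int[of "x - y" p] by linarith
  qed
  ultimately have "nat ((p - 1) div 2) \<le> card (usq p)"
    by (simp add: card_image)
  moreover obtain k where "p = 2 * k + 1"
    using p prime_odd_int oddE by blast
  ultimately show ?thesis
    by simp
qed

text \<open>With \<open>n = card (usq p)\<close>, \<open>p - 1 \<le> 2 * n \<le> 5 * (n - 1)\<close>
  as soon as \<open>n \<ge> 2\<close>.\<close>

lemma block_solvable_5_no_blocks_prime:
  assumes p: "prime p" "p \<ge> 5"
  shows "block_solvable {1..5::nat} {} p"
proof (rule block_solvable_prime[OF p(1)])
  show "index_choice (card (usq p)) (nat p - 1) {1..5::nat} {}"
  proof (rule index_choice_no_blocks)
    have "nat p \<le> 2 * card (usq p) + 1" "nat p \<ge> 5"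
      using card_usq_prime_ge[of p] p by auto
    then show "card (usq p) > 0" "nat p - 1 \<le> card {1..5::nat} * (card (usq p) - 1)"
      by auto
  qed
qed auto

text \<open>With \<open>n = card (usq p)\<close>, the rank bound follows from
  \<open>2 * n \<le> n - 1 + (3 * n - 3) div 2\<close>. This holds from \<open>n = 5\<close> on,
  with equality there, hence the bound 11.\<close>

lemma block_solvable_5_prime:
  assumes p: "prime p" "p \<ge> 11"
  shows "block_solvable {1..5::nat} {{1, 2}, {3, 4, 5}} p"
proof (rule block_solvable_prime[OF p(1)])
  show "index_choice (card (usq p)) (nat p - 1) {1..5::nat} {{1, 2}, {3, 4, 5}}"
  proof (rule index_choice_5)
    have "nat p \<le> 2 * card (usq p) + 1" "nat p \<ge> 11"
      using card_usq_prime_ge[of p] p by auto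
    then show "card (usq p) > 0"
      "nat p - 1 \<le> card (usq p) - 1 + (3 * card (usq p) - 3) div 2"
      by linarith+
  qed
qed auto

text \<open>Here \<open>2 * n \<le> 3 * (n - 1)\<close> is what has to hold, that is
  \<open>n \<ge> 3\<close>, with equality at \<open>n = 3\<close>.\<close>

lemma block_solvable_6_prime:
  assumes p: "prime p" "p \<ge> 7"
  shows "block_solvable {1..6::nat} {{1, 4}, {2, 5}, {3, 6}} p"
proof (rule block_solvable_prime[OF p(1)])
  show "index_choice (card (usq p)) (nat p - 1) {1..6::nat} {{1, 4}, {2, 5}, {3, 6}}"
  proof (rule index_choice_6)
    have "nat p \<le> 2 * card (usq p) + 1" "nat p \<ge> 7"
      using card_usq_prime_ge[of p] p by auto
    then show "card (usq p) > 0" "nat p - 1 \<le> 3 * (card (usq p) - 1)"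
      by linarith+
  qed
qed auto

section \<open>Fibre averages and thresholds\<close>

lemma average_on_le:
  assumes "finite A" "A \<noteq> {}" "\<And>x. x \<in> A \<Longrightarrow> f x \<le> c"
  shows "average_on A f \<le> c"
proof -
  have "(\<Sum>x\<in>A. f x) \<le> real (card A) * c"
    using sum_bounded_above[of A f c] assms(3) by simp
  then show ?thesis
    using assms(1,2) by (simp add: average_on_def divide_simps card_gt_0_iff mult.commute)
qed

text \<open>The deficits \<open>1 - F x\<close> are nonnegative with total below
  \<open>card A * \<epsilon>\<close>, so a single one is below that too.\<close>

lemma average_on_fibre_gt:
  assumes A: "finite A" "u \<in> A" and F: "\<And>x. x \<in> A \<Longrightarrow> F x \<le> 1"
    and avg: "average_on A F > 1 - \<epsilon>"
  shows "F u > 1 - real (card A) * \<epsilon>"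
proof -
  have c: "card A > 0"
    using A by (auto simp: card_gt_0_iff)
  have "1 - F u \<le> (\<Sum>x\<in>A. 1 - F x)"
    using A F by (intro member_le_sum) auto
  also have "\<dots> = real (card A) - (\<Sum>x\<in>A. F x)"
    by (simp add: sum_subtractf)
  also have "\<dots> < real (card A) * \<epsilon>"
    using avg c by (simp add: average_on_def field_simps)
  finally show ?thesis
    by simp
qed

section \<open>Unit squares modulo 5, 7 and 24\<close>

lemma usq_5: "usq 5 = {1, 4}"
proof (intro subset_antisym subsetI)
  fix x assume "x \<in> usq 5"
  then obtain y where y: "coprime y 5" "x = (y mod 5)\<^sup>2 mod 5"
    by (auto simp: usq_def cong_def power_mod)
  then have "y mod 5 \<noteq> 0"
    by auto
  then have "y mod 5 = 1 \<or> y mod 5 = 2 \<or> y mod 5 = 3 \<or> y mod 5 = 4"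
    by presburger
  then show "x \<in> {1, 4}"
    using y(2) by auto
next
  have "coprime (2::int) 5"
    by simp
  then have "4 \<in> usq 5"
    by (auto simp: usq_def cong_def intro!: exI[of _ 2])
  then show "x \<in> usq 5" if "x \<in> {1, 4}" for x
    using that one_in_usq[of 5] by auto
qed

lemma card_usq_7: "card (usq 7) \<le> 3"
proof -
  have "usq 7 \<subseteq> {1, 2, 4}"
  proof
    fix x assume "x \<in> usq 7"
    then obtain y where y: "coprime y 7" "x = (y mod 7)\<^sup>2 mod 7"
      by (auto simp: usq_def cong_def power_mod)
    then have "y mod 7 \<noteq> 0"
      by auto
    then have "y mod 7 = 1 \<or> y mod 7 = 2 \<or> y mod 7 = 3 \<or> y mod 7 = 4 \<or> y mod 7 = 5 \<or> y mod 7 = 6"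
      by presburger
    then show "x \<in> {1, 2, 4}"
      using y(2) by auto
  qed
  from card_mono[OF _ this] show ?thesis
    by simp
qed

lemma usq_24: "usq 24 = {1}"
proof -
  have "x = 1" if x: "x \<in> usq 24" for x
  proof -
    obtain y where y: "coprime y 24" "[x = y\<^sup>2] (mod 24)"
      using x by (auto simp: usq_def)
    have odd: "odd y" "\<not> 3 dvd y"
      using y(1) coprime_common_divisor[of y 24 2] coprime_common_divisor[of y 24 3] by auto
    then obtain k where k: "y = 2 * k + 1"
      using oddE by blast
    \<comment> \<open>Since \<open>y * y - 1 = 4 * k * (k + 1)\<close>, this evenness gives
      divisibility by 8.\<close>
    have "even (k * (k + 1))"
      by simp
    then obtain l where "k * (k + 1) = 2 * l"
      by blast
    then have "y\<^sup>2 - 1 = 8 * l"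
      by (simp add: k power2_eq_square algebra_simps)
    then have "8 dvd y\<^sup>2 - 1"
      by simp
    moreover have "3 dvd (y - 1) \<or> 3 dvd (y + 1)"
      using odd(2) by presburger
    then have "3 dvd (y - 1) * (y + 1)"
      by auto
    then have "3 dvd y\<^sup>2 - 1"
      by (simp add: power2_eq_square algebra_simps)
    moreover have "coprime (8::int) 3"
      by (subst coprime_iff_gcd_eq_1, subst gcd_red_int, subst gcd_red_int, simp)
    ultimately have "8 * 3 dvd y\<^sup>2 - 1"
      by (intro divides_mult)
    then have "[y\<^sup>2 = 1] (mod 24)"
      by (simp add: cong_iff_dvd_diff)
    then show ?thesis
      using y(2) mod_usq_eq[OF x] by (simp add: cong_def)
  qed
  then show ?thesis
    using one_in_usq[of 24] by auto
qed

section \<open>At least six variables\<close>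

text \<open>
  A pair whose values sum to more than \<open>1\<close> cannot contain a value \<open>\<le> 0\<close>, which is how the
  nonvanishing of the \<open>f (x j)\<close> survives the averaging.
\<close>

lemma solvable_of_paired_averages:
  fixes g :: "nat \<Rightarrow> int \<Rightarrow> real"
  assumes H: "H > 0" "squarefree H" "\<And>p. prime p \<Longrightarrow> p dvd H \<Longrightarrow> p \<ge> 7"
    and s: "s \<ge> 6"
    and le1: "\<And>j v. v \<in> usq H \<Longrightarrow> g j v \<le> 1"
    and pos: "\<And>j. average_on (usq H) (g j) > 0"
    and pair: "\<And>j. j \<in> {1, 2, 3} \<Longrightarrow> average_on (usq H) (g j) + average_on (usq H) (g (j + 3)) > 1"
  shows "\<exists>x. (\<forall>j\<in>{1..s}. x j \<in> usq H) \<and> [(\<Sum>j=1..s. x j) = y] (mod H) \<and>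
    (\<Sum>j=1..s. average_on (usq H) (g j)) \<le> (\<Sum>j=1..s. g j (x j)) \<and> (\<forall>j\<in>{1..s}. g j (x j) > 0)"
proof -
  \<comment> \<open>Variables from the seventh on are fixed one by one at or above their averages;
    the first six then absorb the remaining sum.\<close>
  have "\<forall>j. \<exists>v. v \<in> usq H \<and> average_on (usq H) (g j) \<le> g j v"
    using exists_ge_average_on[OF finite_usq usq_nonempty[OF H(1)]] by blast
  then obtain z where z: "\<And>j. z j \<in> usq H" "\<And>j. average_on (usq H) (g j) \<le> g j (z j)"
    by (auto dest!: choice)
  have "block_solvable {1..6::nat} {{1, 4}, {2, 5}, {3, 6}} H"
    using H(1,2) by (rule block_solvable_squarefree) (use H(3) block_solvable_6_prime in blast)
  from this[unfolded block_solvable_def, rule_format, of "y - (\<Sum>j\<in>{7..s}. z j)" g]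
  obtain w where w: "\<forall>j\<in>{1..6}. w j \<in> usq H"
    "[(\<Sum>j\<in>{1..6}. w j) = y - (\<Sum>j\<in>{7..s}. z j)] (mod H)"
    "\<forall>B\<in>{{1, 4}, {2, 5}, {3, 6}}. (\<Sum>j\<in>B. average_on (usq H) (g j)) \<le> (\<Sum>j\<in>B. g j (w j))"
    by blast
  define x where "x = (\<lambda>j. if j \<le> 6 then w j else z j)"
  have I6: "{1..6::nat} = {1, 2, 3, 4, 5, 6}"
    by auto
  have I: "{1..s} = {1..6} \<union> {7..s}"
    using s by auto
  have split: "(\<Sum>j=1..s. h j) = (\<Sum>j=1..6. h j) + (\<Sum>j=7..s. h j)" for h :: "nat \<Rightarrow> 'b::comm_monoid_add"
    unfolding I by (rule sum.union_disjoint) auto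
  have pairs: "average_on (usq H) (g j) + average_on (usq H) (g (j + 3)) \<le> g j (w j) + g (j + 3) (w (j + 3))"
    if "j \<in> {1, 2, 3}" for j
    using that w(3) by (elim insertE) simp_all
  have xin: "\<forall>j\<in>{1..s}. x j \<in> usq H"
    using w(1) z(1) by (simp add: x_def)
  have xsum: "[(\<Sum>j=1..s. x j) = y] (mod H)"
  proof -
    have "(\<Sum>j=1..6. x j) = (\<Sum>j=1..6. w j)" "(\<Sum>j=7..s. x j) = (\<Sum>j=7..s. z j)"
      by (rule sum.cong; simp add: x_def)+
    then have "(\<Sum>j=1..s. x j) = (\<Sum>j=1..6. w j) + (\<Sum>j=7..s. z j)"
      by (simp only: split)
    then show ?thesis
      using cong_add[OF w(2) cong_refl[of "\<Sum>j=7..s. z j"]] by simp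
  qed
  have "(\<Sum>j=1..6. average_on (usq H) (g j)) \<le> (\<Sum>j=1..6. g j (x j))"
    using pairs[of 1] pairs[of 2] pairs[of 3] unfolding I6 by (simp add: x_def)
  moreover have "(\<Sum>j=7..s. average_on (usq H) (g j)) \<le> (\<Sum>j=7..s. g j (x j))"
    using z(2) by (intro sum_mono) (simp add: x_def)
  ultimately have xavg: "(\<Sum>j=1..s. average_on (usq H) (g j)) \<le> (\<Sum>j=1..s. g j (x j))"
    unfolding split by linarith
  have pair_pos: "g j (w j) > 0 \<and> g (j + 3) (w (j + 3)) > 0" if j: "j \<in> {1, 2, 3}" for j
  proof -
    have "w j \<in> usq H" "w (j + 3) \<in> usq H"
      using j w(1) by auto
    then show ?thesis
      using pairs[OF j] pair[OF j] le1[of "w j" j] le1[of "w (j + 3)" "j + 3"] by linarith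
  qed
  have xpos: "g j (x j) > 0" if "j \<in> {1..s}" for j
  proof (cases "j \<le> 6")
    case True
    then have "j \<in> {1, 2, 3, 4, 5, 6}"
      using that by auto
    moreover have "g i (w i) > 0" if "i \<in> {1, 2, 3, 4, 5, 6}" for i
      using that pair_pos[of 1] pair_pos[of 2] pair_pos[of 3] by (elim insertE) simp_all
    ultimately show ?thesis
      using True by (simp add: x_def)
  next
    case False
    then show ?thesis
      using z(2)[of j] pos[of j] by (simp add: x_def)
  qed
  show ?thesis
    using xin xsum xavg xpos by blast
qed

text \<open>\<open>a\<close> and \<open>b\<close> stand for the fibre averages at the better and the
  worse residue modulo 5. The bound is the worst case \<open>(s - 4) * a + 4 * b\<close>, four
  variables at the worse residue. For \<open>s = 6\<close> and \<open>s = 7\<close>,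
  \<open>a \<le> 1\<close> forces \<open>b\<close> up to make up for the loss.\<close>

lemma thresholds_of_two_averages:
  fixes a b :: real
  assumes s: "s \<ge> 6" and ab: "b \<le> a" "a \<le> 1" "a + b > 2 * D_threshold s"
  shows "real s * d_threshold s < (real s - 4) * (a - b) + real s * b"
    and "b > 0" and "a + b > 1" and "s \<le> 7 \<Longrightarrow> b > 1 / 2"
proof -
  consider "s = 6" | "s = 7" | "8 \<le> s" "s \<le> 12" | "s \<ge> 13"
    using s by linarith
  then have *: "real s * d_threshold s < (real s - 4) * (a - b) + real s * b \<and> a + b > 1 \<and> (s \<le> 7 \<longrightarrow> b > 1 / 2)"
  proof cases
    case 1
    then show ?thesis
      using ab by (simp add: D_threshold_def d_threshold_def)
  next
    case 2
    then show ?thesis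
      using ab by (simp add: D_threshold_def d_threshold_def)
  next
    case 3
    have eq: "D_threshold s = d_threshold s"
      using 3 by (simp add: D_threshold_def d_threshold_def)
    have "real s * (2 * D_threshold s) < real s * (a + b)"
      using ab 3 by (intro mult_strict_left_mono) auto
    \<comment> \<open>Twice the worst case equals \<open>s * (a + b) + (s - 8) * (a - b)\<close>, so
      from \<open>s = 8\<close> on the mean of \<open>a\<close> and \<open>b\<close> is a lower
      bound per variable.\<close>
    moreover have "(real s - 8) * (a - b) \<ge> 0"
      using ab 3 by (intro mult_nonneg_nonneg) auto
    moreover have "D_threshold s \<ge> 1 / 2"
      using 3 by (simp add: D_threshold_def divide_simps)
    ultimately show ?thesis
      using 3 ab eq by (simp add: algebra_simps)
  next
    case 4
    have eq: "D_threshold s = 1 / 2" "d_threshold s = 1 / 2"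
      using 4 by (simp_all add: D_threshold_def d_threshold_def)
    have "real s * (2 * D_threshold s) < real s * (a + b)"
      using ab 4 by (intro mult_strict_left_mono) auto
    moreover have "(real s - 8) * (a - b) \<ge> 0"
      using ab 4 by (intro mult_nonneg_nonneg) auto
    ultimately show ?thesis
      using 4 ab unfolding eq by (simp add: algebra_simps)
  qed
  then show "real s * d_threshold s < (real s - 4) * (a - b) + real s * b" "a + b > 1" "s \<le> 7 \<Longrightarrow> b > 1 / 2"
    by blast+
  show "b > 0"
    using * ab by linarith
qed

lemma solvable_ge_6:
  fixes f :: "int \<Rightarrow> real"
  assumes W: "W > 0" "squarefree W" "\<And>p. prime p \<Longrightarrow> p dvd W \<Longrightarrow> p \<ge> 5"
    and s: "s \<ge> 6"
    and f: "\<And>x. x \<in> usq W \<Longrightarrow> f x \<le> 1" and avg: "average_on (usq W) f > D_threshold s"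
  shows "\<exists>x. (\<forall>j\<in>{1..s}. x j \<in> usq W) \<and> [(\<Sum>j=1..s. x j) = y] (mod W) \<and>
    real s * d_threshold s < (\<Sum>j=1..s. f (x j)) \<and> (\<forall>j\<in>{1..s}. f (x j) > 0)"
proof (cases "5 dvd W")
  case False
  have large: "p \<ge> 7" if "prime p" "p dvd W" for p
  proof -
    have "p \<noteq> 5"
      using False that(2) by blast
    moreover have "p \<noteq> 6"
      using that(1) by (auto dest: prime_odd_int)
    ultimately show ?thesis
      using W(3)[OF that] by linarith
  qed
  define a where "a = average_on (usq W) f"
  have "a \<le> 1"
    unfolding a_def using usq_nonempty[OF W(1)] f by (intro average_on_le) auto
  \<comment> \<open>Without the prime 5 there is a single average, so \<open>a = b\<close>.\<close>
  then have thr: "real s * d_threshold s < real s * a" "a > 0" "a + a > 1"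
    using thresholds_of_two_averages[OF s, of a a] avg unfolding a_def by auto
  have "\<exists>x. (\<forall>j\<in>{1..s}. x j \<in> usq W) \<and> [(\<Sum>j=1..s. x j) = y] (mod W) \<and>
    (\<Sum>j=1..s. average_on (usq W) f) \<le> (\<Sum>j=1..s. f (x j)) \<and> (\<forall>j\<in>{1..s}. f (x j) > 0)"
    by (rule solvable_of_paired_averages[OF W(1,2) large s, where g = "\<lambda>_. f"])
      (use f thr in \<open>auto simp: a_def\<close>)
  then obtain x where "\<forall>j\<in>{1..s}. x j \<in> usq W" "[(\<Sum>j=1..s. x j) = y] (mod W)"
    "real s * a \<le> (\<Sum>j=1..s. f (x j))" "\<forall>j\<in>{1..s}. f (x j) > 0"
    by (auto simp: a_def)
  then show ?thesis
    using thr(1) by (intro exI[of _ x]) auto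
next
  case True
  then obtain H where H: "W = 5 * H"
    by blast
  have H0: "H > 0"
    using W(1) H by simp
  have sqH: "squarefree H"
    using W(2) H squarefree_mono by (metis dvd_triv_right)
  have cop: "coprime 5 H"
    using W(2) H squarefree_mult_imp_coprime by blast
  have crt: "(5::int) > 0" "H > 0" "coprime 5 H"
    using H0 cop by simp_all
  have large: "p \<ge> 7" if "prime p" "p dvd H" for p
  proof -
    have "p \<noteq> 5"
      using cop that by (metis coprime_absorb_left not_prime_unit)
    moreover have "p \<noteq> 6"
      using that(1) by (auto dest: prime_odd_int)
    moreover have "p \<ge> 5"
      using W(3) that H by simp
    ultimately show ?thesis
      by linarith
  qed
  define F where "F = (\<lambda>u. average_on (usq H) (\<lambda>v. f (crt 5 H u v)))"
  have F1: "F u \<le> 1" if "u \<in> usq 5" for u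
    unfolding F_def using usq_nonempty[OF H0] f crt_in_usq[OF crt that] H
    by (intro average_on_le) auto
  have "average_on (usq 5) F > D_threshold s"
    using avg unfolding H average_on_usq_mult[OF crt] F_def .
  then have F: "F 1 + F 4 > 2 * D_threshold s"
    by (simp add: usq_5 average_on_def)
  \<comment> \<open>\<open>e\<close> is the residue with the larger fibre average;
    \<open>5 - e\<close> represents \<open>-e\<close>.\<close>
  obtain e where e: "e \<in> {1, 4}" "F (5 - e) \<le> F e"
    by (cases "F 4 \<le> F 1") (force intro: that[of 1] that[of 4])+
  have e5: "e \<in> usq 5" "5 - e \<in> usq 5"
    using e(1) by (auto simp: usq_5)
  have "F e + F (5 - e) > 2 * D_threshold s"
    using F e(1) by auto
  note thr = thresholds_of_two_averages[OF s e(2) F1[OF e5(1)] this]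
  \<comment> \<open>With \<open>s - r\<close> copies of \<open>e\<close> and \<open>r\<close> copies of \<open>-e\<close> the sum is \<open>e (s - 2 r)\<close> mod 5;
    solve for \<open>r\<close>, using \<open>e\<^sup>2 = 1\<close> mod 5.\<close>
  define r where "r = nat ((3 * (int s - e * y)) mod 5)"
  define m where "m = s - r"
  have r: "int r = (3 * (int s - e * y)) mod 5" "r \<le> 4"
    by (simp_all add: r_def nat_le_iff)
  have m: "m \<le> s" "m + r = s" "m + 4 \<ge> s"
    using r(2) s by (auto simp: m_def)
  define u where "u = (\<lambda>j. if j \<le> m then e else 5 - e)"
  have u5: "u j \<in> usq 5" for j
    using e5 by (simp add: u_def)
  have sum_u: "(\<Sum>j=1..s. h (u j)) = of_nat m * h e + of_nat (s - m) * h (5 - e)" for h :: "int \<Rightarrow> 'b::comm_semiring_1"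
  proof -
    have "{1..s} = {1..m} \<union> {m<..s}"
      using m(1) by auto
    moreover have "{1..m} \<inter> {m<..s} = {}"
      by auto
    ultimately have "(\<Sum>j=1..s. h (u j)) = (\<Sum>j=1..m. h (u j)) + (\<Sum>j\<in>{m<..s}. h (u j))"
      by (simp only: sum.union_disjoint finite_atLeastAtMost finite_greaterThanAtMost)
    also have "(\<Sum>j=1..m. h (u j)) = (\<Sum>j=1..m. h e)"
      by (rule sum.cong) (auto simp: u_def)
    also have "(\<Sum>j\<in>{m<..s}. h (u j)) = (\<Sum>j\<in>{m<..s}. h (5 - e))"
      by (rule sum.cong) (auto simp: u_def)
    finally show ?thesis
      by simp
  qed
  have usum: "[(\<Sum>j=1..s. u j) = y] (mod 5)"
  proof -
    have "(\<Sum>j=1..s. u j) = int m * e + int r * (5 - e)"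
      using sum_u[of "\<lambda>x. x"] m by simp
    also have "\<dots> = int s * e - 2 * e * int r + 5 * int r"
      unfolding m(2)[symmetric] by (simp add: algebra_simps)
    finally have "(\<Sum>j=1..s. u j) = int s * e - 2 * e * int r + 5 * int r" .
    moreover have "[int s * e - 2 * e * int r + 5 * int r = int s * e - 2 * e * (3 * (int s - e * y)) + 0] (mod 5)"
      by (intro cong_add cong_diff cong_mult cong_refl) (auto simp: r cong_def)
    \<comment> \<open>\<open>3\<close> inverts \<open>2\<close> modulo 5, so the terms in
      \<open>s\<close> cancel and \<open>6 * e * e * y\<close> reduces to \<open>y\<close>.\<close>
    moreover have "[int s * e - 2 * e * (3 * (int s - e * y)) + 0 = y] (mod 5)"
      using e(1) by (auto simp: cong_iff_dvd_diff)
    ultimately show ?thesis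
      using cong_trans by simp
  qed
  have u_pos: "F (u j) > 0" for j
    using thr(2) e(2) by (simp add: u_def)
  \<comment> \<open>For \<open>s \<le> 7\<close> even the worse average exceeds one half. For
    \<open>s \<ge> 8\<close>, \<open>m \<ge> 4\<close>, so the first member of each pair sits at the
    better residue.\<close>
  have pair: "F (u j) + F (u (j + 3)) > 1" if j: "j \<in> {1, 2, 3}" for j
  proof (cases "s \<le> 7")
    case True
    then show ?thesis
      using thr(4) e(2) by (simp add: u_def)
  next
    case False
    then have "j \<le> m"
      using m(3) j by auto
    then show ?thesis
      using thr(3) e(2) by (simp add: u_def)
  qed
  obtain v where v: "\<forall>j\<in>{1..s}. v j \<in> usq H" "[(\<Sum>j=1..s. v j) = y] (mod H)"
    "(\<Sum>j=1..s. F (u j)) \<le> (\<Sum>j=1..s. f (crt 5 H (u j) (v j)))"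
    "\<forall>j\<in>{1..s}. f (crt 5 H (u j) (v j)) > 0"
  proof -
    have "\<exists>v. (\<forall>j\<in>{1..s}. v j \<in> usq H) \<and> [(\<Sum>j=1..s. v j) = y] (mod H) \<and>
      (\<Sum>j=1..s. average_on (usq H) (\<lambda>v. f (crt 5 H (u j) v))) \<le> (\<Sum>j=1..s. f (crt 5 H (u j) (v j))) \<and>
      (\<forall>j\<in>{1..s}. f (crt 5 H (u j) (v j)) > 0)"
    proof (rule solvable_of_paired_averages[OF H0 sqH large s, where g = "\<lambda>j v. f (crt 5 H (u j) v)"])
      show "f (crt 5 H (u j) v) \<le> 1" if "v \<in> usq H" for j v
        using f crt_in_usq[OF crt u5 that] H by simp
      show "average_on (usq H) (\<lambda>v. f (crt 5 H (u j) v)) > 0" for j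
        using u_pos[of j] by (simp add: F_def)
      show "average_on (usq H) (\<lambda>v. f (crt 5 H (u j) v)) +
          average_on (usq H) (\<lambda>v. f (crt 5 H (u (j + 3)) v)) > 1" if "j \<in> {1, 2, 3}" for j
        using pair[OF that] by (simp add: F_def)
    qed auto
    then show thesis
      using that by (auto simp: F_def)
  qed
  \<comment> \<open>\<open>m \<ge> s - 4\<close> reduces the actual split to the worst case of the
    threshold lemma.\<close>
  have "(real s - 4) * (F e - F (5 - e)) + real s * F (5 - e) \<le> real m * (F e - F (5 - e)) + real s * F (5 - e)"
    using m(3) e(2) by (intro add_right_mono mult_right_mono) auto
  also have "\<dots> = (\<Sum>j=1..s. F (u j))"
    using sum_u[of F] m(1) by (simp add: of_nat_diff algebra_simps)
  finally have "real s * d_threshold s < (\<Sum>j=1..s. f (crt 5 H (u j) (v j)))"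
    using thr(1) v(3) by linarith
  moreover have "[(\<Sum>j=1..s. crt 5 H (u j) (v j)) = y] (mod W)"
    using sum_crt_cong[OF crt usum v(2)] H by simp
  moreover have "\<forall>j\<in>{1..s}. crt 5 H (u j) (v j) \<in> usq W"
    using crt_in_usq[OF crt u5] v(1) H by simp
  ultimately show ?thesis
    using v(4) by (intro exI[of _ "\<lambda>j. crt 5 H (u j) (v j)"]) auto
qed

section \<open>Five variables\<close>

text \<open>The primes 5 and 7 are collected in \<open>G\<close>. Every fibre over \<open>G\<close>
  has a large average, so there only the sum has to be met; the primes of the cofactor
  \<open>H\<close> are at least 11 and lose nothing.\<close>

lemma solvable_5:
  fixes f :: "int \<Rightarrow> real"
  assumes W: "W > 0" "squarefree W" "\<And>p. prime p \<Longrightarrow> p dvd W \<Longrightarrow> p \<ge> 5"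
    and f: "\<And>x. x \<in> usq W \<Longrightarrow> f x \<le> 1" and avg: "average_on (usq W) f > 59 / 60"
  shows "\<exists>x. (\<forall>j\<in>{1..5::nat}. x j \<in> usq W) \<and> [(\<Sum>j=1..5. x j) = y] (mod W) \<and>
    9 / 2 < (\<Sum>j=1..5. f (x j)) \<and> (\<forall>j\<in>{1..5}. f (x j) > 0)"
proof -
  define G where "G = (if 5 dvd W then 5 else 1) * (if 7 dvd W then 7 else 1 :: int)"
  have cop57: "coprime (5::int) 7"
    by (rule primes_coprime) simp_all
  have "G dvd W"
    unfolding G_def using cop57 by (intro divides_mult) auto
  then obtain H where H: "W = G * H"
    by blast
  have G0: "G > 0"
    by (simp add: G_def)
  have H0: "H > 0"
    using W(1) H G0 by (simp add: zero_less_mult_iff)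
  have sq: "squarefree G" "squarefree H"
    using W(2) H squarefree_mono by (metis dvd_triv_left dvd_triv_right)+
  have cop: "coprime G H"
    using W(2) H squarefree_mult_imp_coprime by blast
  note crt = G0 H0 cop
  have large: "p \<ge> 11" if p: "prime p" "p dvd H" for p
  proof -
    have "\<not> p dvd G"
      using cop p by (meson coprime_common_divisor not_prime_unit)
    moreover have "p dvd W"
      using p(2) H by simp
    ultimately have "p \<noteq> 5" "p \<noteq> 7"
      by (auto simp: G_def)
    moreover have "odd p" "p \<ge> 5"
      using W(3)[OF p(1) \<open>p dvd W\<close>] prime_odd_int[OF p(1)] by auto
    moreover have "p \<noteq> 9"
    proof
      assume "p = 9"
      then have "3 dvd p"
        by simp
      then show False
        using p(1) \<open>p = 9\<close> prime_int_iff[of p] by auto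
    qed
    ultimately show ?thesis
      by presburger
  qed
  have cardG: "card (usq G) \<le> 6"
  proof -
    have "card (usq (5 * 7)) = card (usq 5) * card (usq 7)"
      using cop57 by (intro card_usq_mult) auto
    then show ?thesis
      using card_usq_7 by (simp add: G_def usq_1 usq_5)
  qed
  define F where "F = (\<lambda>u. average_on (usq H) (\<lambda>v. f (crt G H u v)))"
  have F1: "F u \<le> 1" if "u \<in> usq G" for u
    unfolding F_def using usq_nonempty[OF H0] f crt_in_usq[OF crt that] H
    by (intro average_on_le) auto
  have "average_on (usq G) F > 1 - 1 / 60"
    using avg unfolding H average_on_usq_mult[OF crt] F_def by simp
  \<comment> \<open>At most six residues, each absorbing at most the total deficit:
    \<open>1 - 6 / 60\<close>.\<close>
  then have F: "F u > 9 / 10" if "u \<in> usq G" for u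
    using average_on_fibre_gt[OF finite_usq that F1] cardG by fastforce
  have "block_solvable {1..5::nat} {} G"
    using G0 sq(1)
  proof (rule block_solvable_squarefree)
    fix p assume "prime p" "p dvd G"
    then show "block_solvable {1..5::nat} {} p"
      using W(3) H by (intro block_solvable_5_no_blocks_prime) auto
  qed
  \<comment> \<open>With no blocks any functions do; zero is a placeholder.\<close>
  from this[unfolded block_solvable_def, rule_format, of y "\<lambda>_ _. 0"]
  obtain u where u: "\<forall>j\<in>{1..5::nat}. u j \<in> usq G" "[(\<Sum>j=1..5. u j) = y] (mod G)"
    by blast
  have "block_solvable {1..5::nat} {{1, 2}, {3, 4, 5}} H"
    using H0 sq(2) by (rule block_solvable_squarefree) (use large block_solvable_5_prime in blast)
  from this[unfolded block_solvable_def, rule_format, of y "\<lambda>j v. f (crt G H (u j) v)"]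
  obtain v where v: "\<forall>j\<in>{1..5::nat}. v j \<in> usq H" "[(\<Sum>j=1..5. v j) = y] (mod H)"
    "\<forall>B\<in>{{1, 2}, {3, 4, 5}}. (\<Sum>j\<in>B. F (u j)) \<le> (\<Sum>j\<in>B. f (crt G H (u j) (v j)))"
    unfolding F_def by blast
  define x where "x = (\<lambda>j. crt G H (u j) (v j))"
  have xin: "x j \<in> usq W" if "j \<in> {1..5}" for j
    unfolding x_def H using u(1) v(1) that crt_in_usq[OF crt] by blast
  have I: "{1..5::nat} = {1, 2, 3, 4, 5}"
    by auto
  have Fu: "F (u j) > 9 / 10" if "j \<in> {1..5}" for j
    using F u(1) that by blast
  have sum: "f (x 1) + f (x 2) + f (x 3) + f (x 4) + f (x 5) > 9 / 2"
    using v(3) Fu[of 1] Fu[of 2] Fu[of 3] Fu[of 4] Fu[of 5] by (simp add: x_def)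
  have fx: "f (x j) \<le> 1" if "j \<in> {1..5}" for j
    using f xin that by blast
  \<comment> \<open>Four of the values contribute at most 4 to a sum above \<open>9 / 2\<close>, so
    the fifth exceeds one half.\<close>
  have "\<forall>j\<in>{1..5}. f (x j) > 0"
    using sum fx[of 1] fx[of 2] fx[of 3] fx[of 4] fx[of 5] unfolding I by simp
  moreover have "9 / 2 < (\<Sum>j=1..5. f (x j))"
    using sum unfolding I by (simp add: algebra_simps)
  moreover have "[(\<Sum>j=1..5. x j) = y] (mod W)"
    unfolding x_def H using sum_crt_cong[OF crt u(2) v(2)] .
  ultimately show ?thesis
    using xin by blast
qed

section \<open>Removing the factor 24\<close>

theorem theorem8p2:
  fixes s :: nat and W :: int and f :: "int \<Rightarrow> real"
  assumes "s \<ge> 5"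
    and "W > 0" and "squarefree W" and "gcd 24 W = 1"
    and "f \<in> unit_squares (24 * W) \<rightarrow> {0..1}"
    and "average_on (unit_squares (24 * W)) f > D_threshold s"
  shows "\<forall>y \<in> carrier (residue_ring (24 * W)). [y = int s] (mod 24) \<longrightarrow>
    (\<exists>x :: nat \<Rightarrow> int.
       (\<forall>j \<in> {1..s}. x j \<in> unit_squares (24 * W)) \<and>
       y = (\<Oplus>\<^bsub>residue_ring (24 * W)\<^esub> j \<in> {1..s}. x j) \<and>
       1 / real s * (\<Sum>j = 1..s. f (x j)) > d_threshold s \<and>
       (\<forall>j \<in> {1..s}. f (x j) \<noteq> 0))"
proof (intro ballI impI)
  fix y assume y: "y \<in> carrier (residue_ring (24 * W))" "[y = int s] (mod 24)"
  interpret residues "24 * W" "residue_ring (24 * W)"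
    by unfold_locales (use assms(2) in auto)
  have us: "unit_squares (24 * W) = usq (24 * W)"
    using assms(2) by (intro unit_squares_eq_usq) auto
  have cop: "coprime 24 W"
    using assms(4) by (simp add: coprime_iff_gcd_eq_1)
  have crt: "(24::int) > 0" "W > 0" "coprime 24 W"
    using assms(2) cop by simp_all
  have large: "p \<ge> 5" if p: "prime p" "p dvd W" for p
  proof -
    have "\<not> p dvd 24"
      using cop p by (meson coprime_common_divisor not_prime_unit)
    then have "p \<noteq> 2" "p \<noteq> 3" "p \<noteq> 4"
      by auto
    then show ?thesis
      using prime_ge_2_int[OF p(1)] by linarith
  qed
  \<comment> \<open>\<open>1\<close> is the only unit square modulo 24, so \<open>f\<close> is a
    function on \<open>usq W\<close> in disguise, with the same average.\<close>
  define h where "h = (\<lambda>v. f (crt 24 W 1 v))"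
  have in_usq: "crt 24 W 1 v \<in> usq (24 * W)" if "v \<in> usq W" for v
    using crt_in_usq[OF crt _ that] by (simp add: usq_24)
  have h1: "h v \<le> 1" if "v \<in> usq W" for v
    using in_usq[OF that] assms(5) unfolding us h_def by (auto simp: Pi_iff)
  have avg: "average_on (usq W) h > D_threshold s"
    using assms(6) unfolding us average_on_usq_mult[OF crt] h_def
    by (simp add: usq_24 average_on_def)
  have "\<exists>v. (\<forall>j\<in>{1..s}. v j \<in> usq W) \<and> [(\<Sum>j=1..s. v j) = y] (mod W) \<and>
    real s * d_threshold s < (\<Sum>j=1..s. h (v j)) \<and> (\<forall>j\<in>{1..s}. h (v j) > 0)"
  proof (cases "s = 5")
    case True
    then show ?thesis
      using solvable_5[where y = y, OF assms(2,3) large h1] avg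
      by (simp add: D_threshold_def d_threshold_def)
  next
    case False
    then have "s \<ge> 6"
      using assms(1) by simp
    then show ?thesis
      using solvable_ge_6[where y = y, OF assms(2,3) large _ h1 avg] by blast
  qed
  then obtain v where v: "\<forall>j\<in>{1..s}. v j \<in> usq W" "[(\<Sum>j=1..s. v j) = y] (mod W)"
    "real s * d_threshold s < (\<Sum>j=1..s. h (v j))" "\<forall>j\<in>{1..s}. h (v j) > 0"
    by blast
  define x where "x = (\<lambda>j. crt 24 W 1 (v j))"
  \<comment> \<open>Modulo 24 all summands are \<open>1\<close> and add up to \<open>s\<close>,
    whence the congruence condition on \<open>y\<close>.\<close>
  have "[(\<Sum>j=1..s. 1) = y] (mod 24)"
    using y(2) by (simp add: cong_sym)
  then have "[(\<Sum>j=1..s. x j) = y] (mod 24 * W)"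
    unfolding x_def by (rule sum_crt_cong[OF crt _ v(2)])
  \<comment> \<open>The values of \<open>crt\<close> are already reduced; in this form
    \<open>sum_cong\<close> turns the ring sum into an integer sum modulo
    \<open>24 * W\<close>.\<close>
  moreover have "x = (\<lambda>j. x j mod (24 * W))"
    using crt_in_range[OF crt] by (auto simp: x_def)
  then have "(\<Oplus>\<^bsub>residue_ring (24 * W)\<^esub> j \<in> {1..s}. x j) = (\<Sum>j=1..s. x j) mod (24 * W)"
    using sum_cong[of "{1..s}" x] by simp
  ultimately have "y = (\<Oplus>\<^bsub>residue_ring (24 * W)\<^esub> j \<in> {1..s}. x j)"
    using y(1) by (simp add: res_carrier_eq cong_def)
  moreover have "1 / real s * (\<Sum>j = 1..s. f (x j)) > d_threshold s"
    using v(3) assms(1) by (simp add: h_def x_def field_simps)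
  moreover have "\<forall>j \<in> {1..s}. x j \<in> unit_squares (24 * W)"
    using v(1) in_usq by (simp add: us x_def)
  moreover have "\<forall>j \<in> {1..s}. f (x j) \<noteq> 0"
    using v(4) by (auto simp: h_def x_def)
  ultimately show "\<exists>x :: nat \<Rightarrow> int.
       (\<forall>j \<in> {1..s}. x j \<in> unit_squares (24 * W)) \<and>
       y = (\<Oplus>\<^bsub>residue_ring (24 * W)\<^esub> j \<in> {1..s}. x j) \<and>
       1 / real s * (\<Sum>j = 1..s. f (x j)) > d_threshold s \<and>
       (\<forall>j \<in> {1..s}. f (x j) \<noteq> 0)"
    by blast
qed

end
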